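(* Let $k\ge 1$ be an integer and let $H$ be a labelled multihypergraph on $t\ge 2$ vertices. If $H$ has a $k$-distinguishable tree assignment, then $\rho(H)=k(t-1)$. Consequently, every $k$-weakly-partition-connected hypergraph $H$ on $t\ge2$ vertices satisfying $\rho(H)>k(t-1)$ is a counterexample to the assertion "every $k$-weakly-partition-connected hypergraph has a $k$-distinguishable tree assignment"; that is, such an $H$ has no $k$-distinguishable tree assignment.
   Context: A labelled multihypergraph $H=(V,E)$ has a finite vertex set $V$ and a finite set $E$ of hyperedge occurrences, each with a support that is a subset of $V$ of cardinality at least $2$ (standing assumption); distinct occurrences may have the same support and remain distinct. We write $e$ both for the occurrence and its support. For a partition $\mathcal P$ of $V$ let $p_{\mathcal P}(e)$ be the number of blocks of $\mathcal P$ met by $e$, and $w_H(\mathcal P)=\sum_{e\in E}(p_{\mathcal P}(e)-1)$. $H$ is $k$-weakly-partition-connected if $w_H(\mathcal P)\ge k(|\mathcal P|-1)$ for every partition $\mathcal P$ of $V$. The total excess is $\rho(H)=\sum_{e\in E}(|e|-1)$. A tree assignment of $H$ chooses, for every $e\in E$, a simple tree $F_e$ with vertex set $e$ and labels every edge of $F_e$ by $e$; the assigned graph is the labelled multigraph $G=\biguplus_{e\in E}F_e$ on $V$ (disjoint union of labelled edge occurrences; parallel edges may arise only from distinct labels). An ordered $k$-tree decomposition of a labelled graph $G$ on $V$ is an ordered partition $E(G)=E(T_0)\,\dot\cup\,\cdots\,\dot\cup\,E(T_{k-1})$ of all edge occurrences in which every $T_i$ is a spanning tree of $V$ (containing no parallel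 pair). Its signature is the vector indexed by $e\in E$ with $\mathrm{sig}_{\mathcal T}(e)=\sum_{i=0}^{k-1} i\,|E(T_i)\cap E(F_e)|$. The assignment $G$ is $k$-distinguishable if it has an ordered $k$-tree decomposition $\mathcal T$ such that every ordered $k$-tree decomposition $\mathcal T'$ of $G$ with $\mathrm{sig}_{\mathcal T'}=\mathrm{sig}_{\mathcal T}$ equals $\mathcal T$. *)

theory Defs
  imports Main "HOL-Library.Disjoint_Sets"
begin

section \<open>Labelled multihypergraphs\<close>

text \<open>Hyperedge occurrences are elements of a label type; different labels may have the
  same support.\<close>

record ('v, 'e) multihypergraph =
  hverts :: "'v set"
  hedges :: "'e set"
  supp :: "'e \<Rightarrow> 'v set"

definition labelled_multihypergraph :: "('v, 'e) multihypergraph \<Rightarrow> bool" where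
  "labelled_multihypergraph H \<longleftrightarrow>
     finite (hverts H) \<and> finite (hedges H) \<and>
     (\<forall>e\<in>hedges H. supp H e \<subseteq> hverts H \<and> card (supp H e) \<ge> 2)"

definition blocks_met :: "'v set set \<Rightarrow> 'v set \<Rightarrow> nat" where
  "blocks_met P A = card {B \<in> P. B \<inter> A \<noteq> {}}"

text \<open>The subtractions on natural numbers in the next three definitions do not truncate in a
  labelled multihypergraph with nonempty vertex set: supports, and partitions of the vertex
  set, are then nonempty.\<close>

definition partition_weight :: "('v, 'e) multihypergraph \<Rightarrow> 'v set set \<Rightarrow> nat" where
  "partition_weight H P = (\<Sum>e\<in>hedges H. blocks_met P (supp H e) - 1)"

definition weakly_partition_connected :: "nat \<Rightarrow> ('v, 'e) multihypergraph \<Rightarrow> bool" where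
  "weakly_partition_connected k H \<longleftrightarrow>
     (\<forall>P. partition_on (hverts H) P \<longrightarrow> partition_weight H P \<ge> k * (card P - 1))"

definition total_excess :: "('v, 'e) multihypergraph \<Rightarrow> nat" where
  "total_excess H = (\<Sum>e\<in>hedges H. card (supp H e) - 1)"

section \<open>Simple trees\<close>

text \<open>A simple graph on \<open>U\<close> is given by its set \<open>F\<close> of edges, which are two-element subsets
  of \<open>U\<close>.\<close>

definition simple_graph :: "'v set \<Rightarrow> 'v set set \<Rightarrow> bool" where
  "simple_graph U F \<longleftrightarrow> (\<forall>f\<in>F. f \<subseteq> U \<and> card f = 2)"

definition connected_graph :: "'v set \<Rightarrow> 'v set set \<Rightarrow> bool" where
  "connected_graph U F \<longleftrightarrow>
     U \<noteq> {} \<and> (\<forall>u\<in>U. \<forall>v\<in>U. (u, v) \<in> {(x, y). {x, y} \<in> F}\<^sup>*)"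

definition graph_cycle :: "'v set set \<Rightarrow> 'v list \<Rightarrow> bool" where
  "graph_cycle F c \<longleftrightarrow>
     length c \<ge> 3 \<and> distinct c \<and>
     (\<forall>i<length c. {c ! i, c ! (Suc i mod length c)} \<in> F)"

definition simple_tree :: "'v set \<Rightarrow> 'v set set \<Rightarrow> bool" where
  "simple_tree U F \<longleftrightarrow>
     simple_graph U F \<and> connected_graph U F \<and> \<not> (\<exists>c. graph_cycle F c)"

section \<open>Tree assignments and ordered tree decompositions\<close>

text \<open>An edge occurrence of a labelled multigraph is a pair of its label and its set of two
  ends; a labelled multigraph on a given vertex set is a set of edge occurrences.  Two
  occurrences are parallel if they differ only in their label.\<close>

definition tree_assignment ::
    "('v, 'e) multihypergraph \<Rightarrow> ('e \<Rightarrow> 'v set set) \<Rightarrow> bool" where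
  "tree_assignment H F \<longleftrightarrow> (\<forall>e\<in>hedges H. simple_tree (supp H e) (F e))"

definition labelled_edges :: "('e \<Rightarrow> 'v set set) \<Rightarrow> 'e \<Rightarrow> ('e \<times> 'v set) set" where
  "labelled_edges F e = {e} \<times> F e"

definition assigned_graph ::
    "('v, 'e) multihypergraph \<Rightarrow> ('e \<Rightarrow> 'v set set) \<Rightarrow> ('e \<times> 'v set) set" where
  "assigned_graph H F = (\<Union>e\<in>hedges H. labelled_edges F e)"

text \<open>Injectivity of \<^const>\<open>snd\<close> says that \<open>T\<close> contains no parallel pair.\<close>

definition spanning_tree_occ :: "'v set \<Rightarrow> ('e \<times> 'v set) set \<Rightarrow> bool" where
  "spanning_tree_occ V T \<longleftrightarrow> inj_on snd T \<and> simple_tree V (snd ` T)"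

definition ordered_tree_decomposition ::
    "nat \<Rightarrow> 'v set \<Rightarrow> ('e \<times> 'v set) set \<Rightarrow> ('e \<times> 'v set) set list \<Rightarrow> bool" where
  "ordered_tree_decomposition k V G Ts \<longleftrightarrow>
     length Ts = k \<and>
     (\<Union>i<k. Ts ! i) = G \<and>
     (\<forall>i<k. \<forall>j<k. i \<noteq> j \<longrightarrow> Ts ! i \<inter> Ts ! j = {}) \<and>
     (\<forall>i<k. spanning_tree_occ V (Ts ! i))"

definition signature ::
    "('e \<Rightarrow> 'v set set) \<Rightarrow> ('e \<times> 'v set) set list \<Rightarrow> 'e \<Rightarrow> nat" where
  "signature F Ts e = (\<Sum>i<length Ts. i * card (Ts ! i \<inter> labelled_edges F e))"

definition distinguishable ::
    "nat \<Rightarrow> ('v, 'e) multihypergraph \<Rightarrow> ('e \<Rightarrow> 'v set set) \<Rightarrow> bool" where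
  "distinguishable k H F \<longleftrightarrow>
     (\<exists>Ts. ordered_tree_decomposition k (hverts H) (assigned_graph H F) Ts \<and>
        (\<forall>Ts'. ordered_tree_decomposition k (hverts H) (assigned_graph H F) Ts' \<and>
               (\<forall>e\<in>hedges H. signature F Ts' e = signature F Ts e)
               \<longrightarrow> Ts' = Ts))"

definition has_distinguishable_tree_assignment ::
    "nat \<Rightarrow> ('v, 'e) multihypergraph \<Rightarrow> bool" where
  "has_distinguishable_tree_assignment k H \<longleftrightarrow>
     (\<exists>F. tree_assignment H F \<and> distinguishable k H F)"

end

theory Submission
  imports Defs
begin

text \<open>The assigned graph \<open>G\<close> of a tree assignment has exactly \<open>\<rho>(H)\<close> edge occurrences, because
  a tree on the support of \<open>e\<close> has \<open>|e| - 1\<close> edges.  If \<open>G\<close> splits into \<open>k\<close> spanning trees of a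
  vertex set of size \<open>t\<close>, it also has exactly \<open>k (t - 1)\<close> edge occurrences.  Since
  distinguishability asserts in particular that some decomposition exists, the two counts agree;
  the second half of the theorem is the contrapositive.

  Both counts rest on the edge number of a tree (\<open>card_simple_tree\<close>).  It is obtained by
  inserting the edges of a forest one at a time: acyclicity forces every new edge to join two
  different components (\<open>cycle_of_connected_insert\<close>), so each edge lowers the number of
  components by exactly one (\<open>forest_component_labelling\<close>).\<close>

abbreviation adj :: "'v set set \<Rightarrow> ('v \<times> 'v) set" where
  "adj F \<equiv> {(x, y). {x, y} \<in> F}"

lemma rtrancl_adj_sym: "(x, y) \<in> (adj F)\<^sup>* \<Longrightarrow> (y, x) \<in> (adj F)\<^sup>*"
proof -
  have "sym (adj F)"
    by (auto simp: sym_def insert_commute)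
  then show "(x, y) \<in> (adj F)\<^sup>* \<Longrightarrow> (y, x) \<in> (adj F)\<^sup>*"
    by (meson sym_rtrancl symD)
qed

text \<open>Cycles are required to have distinct vertices, so walks must be shortened to paths: when
  a step returns to a vertex already on the path, the loop after that vertex is cut off.\<close>

lemma distinct_path_of_rtrancl:
  assumes "(x, y) \<in> (adj F)\<^sup>*"
  shows "\<exists>p. p \<noteq> [] \<and> hd p = x \<and> last p = y \<and> distinct p \<and>
    (\<forall>i. Suc i < length p \<longrightarrow> {p ! i, p ! Suc i} \<in> F)"
  using assms
proof (induction rule: rtrancl_induct)
  case base
  show ?case by (rule exI[of _ "[x]"]) simp
next
  case (step y z)
  then obtain p where p: "p \<noteq> []" "hd p = x" "last p = y" "distinct p"
    and edges: "\<And>i. Suc i < length p \<Longrightarrow> {p ! i, p ! Suc i} \<in> F"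
    by blast
  show ?case
  proof (cases "z \<in> set p")
    case True
    then obtain j where j: "j < length p" "p ! j = z"
      by (auto simp: in_set_conv_nth)
    let ?q = "take (Suc j) p"
    have "?q \<noteq> []" "hd ?q = x" "distinct ?q"
      using p by auto
    moreover have "last ?q = z"
      using j by (simp add: take_Suc_conv_app_nth)
    moreover have "\<forall>i. Suc i < length ?q \<longrightarrow> {?q ! i, ?q ! Suc i} \<in> F"
      using edges by simp
    ultimately show ?thesis by blast
  next
    case False
    let ?q = "p @ [z]"
    have "?q \<noteq> []" "hd ?q = x" "last ?q = z" "distinct ?q"
      using p False by auto
    moreover have "{?q ! i, ?q ! Suc i} \<in> F" if "Suc i < length ?q" for i
    proof (cases "Suc i < length p")
      case True
      then show ?thesis using edges by (simp add: nth_append)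
    next
      case False
      then have i: "Suc i = length p" using that by simp
      then have "p ! i = y" using p by (simp add: last_conv_nth flip: i)
      then show ?thesis using i step.hyps(2) by (simp add: nth_append)
    qed
    ultimately show ?thesis by blast
  qed
qed

text \<open>A path between the ends of the new edge is closed up by that edge.  The path has at least
  three vertices because its ends are distinct and not yet adjacent, so the result is a genuine
  cycle.\<close>

lemma cycle_of_connected_insert:
  assumes "(x, y) \<in> (adj F)\<^sup>*" "x \<noteq> y" "{x, y} \<notin> F"
  shows "\<exists>c. graph_cycle (insert {x, y} F) c"
proof -
  obtain p where p: "p \<noteq> []" "hd p = x" "last p = y" "distinct p"
    and edges: "\<And>i. Suc i < length p \<Longrightarrow> {p ! i, p ! Suc i} \<in> F"
    using distinct_path_of_rtrancl[OF assms(1)] by blast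
  have first: "p ! 0 = x" and last: "p ! (length p - 1) = y"
    using p by (simp_all add: hd_conv_nth last_conv_nth)
  have "length p \<noteq> 0" "length p \<noteq> 1" "length p \<noteq> 2"
    using p(1) first last assms(2,3) edges[of 0] by auto
  then have len: "length p \<ge> 3" by linarith
  have "{p ! i, p ! (Suc i mod length p)} \<in> insert {x, y} F" if "i < length p" for i
  proof (cases "Suc i < length p")
    case True
    then show ?thesis using edges by simp
  next
    case False
    then have "Suc i = length p" using that by simp
    then show ?thesis using first last by (simp add: insert_commute flip: \<open>Suc i = length p\<close>)
  qed
  then show ?thesis
    using len p(4) unfolding graph_cycle_def by blast
qed

text \<open>The components of a forest are encoded by a labelling of the vertices that is constant
  exactly on components, so that \<open>h ` U\<close> stands for the set of components.  Inserting an edge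
  \<open>{x, y}\<close> amounts to relabelling the component of \<open>y\<close> by the label of \<open>x\<close>, which loses
  exactly one label.\<close>

lemma forest_component_labelling:
  assumes "finite F" "finite U" "simple_graph U F" "\<nexists>c. graph_cycle F c"
  shows "\<exists>h :: 'v \<Rightarrow> 'v. (\<forall>a b. h a = h b \<longleftrightarrow> (a, b) \<in> (adj F)\<^sup>*) \<and>
    card (h ` U) + card F = card U"
  using assms(1,3,4)
proof (induction F rule: finite_induct)
  case empty
  show ?case by (rule exI[of _ id]) simp
next
  case (insert f F)
  obtain x y where f: "f = {x, y}" "x \<noteq> y" "x \<in> U" "y \<in> U"
    using insert.prems(1) by (auto simp: simple_graph_def card_2_iff)
  have "simple_graph U F" and "\<nexists>c. graph_cycle F c"
    using insert.prems by (auto simp: simple_graph_def graph_cycle_def)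
  then obtain h :: "'v \<Rightarrow> 'v" where h: "\<And>a b. h a = h b \<longleftrightarrow> (a, b) \<in> (adj F)\<^sup>*"
    and count: "card (h ` U) + card F = card U"
    using insert.IH by blast
  have "(x, y) \<notin> (adj F)\<^sup>*"
    using cycle_of_connected_insert[of x y F] insert.hyps(2) insert.prems(2) f by blast
  then have hxy: "h x \<noteq> h y" using h by blast
  define h' where "h' v = (if h v = h y then h x else h v)" for v
  let ?A = "adj (insert f F)"
  have mono: "(a, b) \<in> ?A\<^sup>*" if "h a = h b" for a b
  proof -
    have "(adj F)\<^sup>* \<subseteq> ?A\<^sup>*" by (rule rtrancl_mono) auto
    then show ?thesis using that h by blast
  qed
  have xy: "(x, y) \<in> ?A\<^sup>*" "(y, x) \<in> ?A\<^sup>*"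
    using f(1) by (auto simp: insert_commute)
  have "(a, b) \<in> ?A\<^sup>*" if "h' a = h' b" for a b
  proof -
    have to_x: "(v, x) \<in> ?A\<^sup>*" if "h' v = h x" for v
      using that mono[of v x] mono[of v y] xy(2)
      by (auto simp: h'_def intro: rtrancl_trans split: if_splits)
    show ?thesis
    proof (cases "h' a = h x")
      case True
      then have "(a, x) \<in> ?A\<^sup>*" "(b, x) \<in> ?A\<^sup>*" using to_x that by auto
      then show ?thesis using rtrancl_adj_sym[of b x] by (meson rtrancl_trans)
    next
      case False
      then show ?thesis using that mono[of a b] by (auto simp: h'_def split: if_splits)
    qed
  qed
  moreover have "h' a = h' b" if "(a, b) \<in> ?A\<^sup>*" for a b
    using that
  proof (induction rule: rtrancl_induct)
    case (step b c)
    have "h' b = h' c"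
    proof (cases "{b, c} = f")
      case True
      then have "b = x \<and> c = y \<or> b = y \<and> c = x"
        using f(1) by (simp add: doubleton_eq_iff)
      then show ?thesis by (auto simp: h'_def)
    next
      case False
      then have "h b = h c" using step.hyps(2) h by blast
      then show ?thesis by (simp add: h'_def)
    qed
    then show ?case using step.IH by simp
  qed simp
  ultimately have "\<forall>a b. h' a = h' b \<longleftrightarrow> (a, b) \<in> ?A\<^sup>*" by blast
  moreover have "h' ` U = h ` U - {h y}"
    using f(3) hxy by (auto simp: h'_def image_iff)
  then have "Suc (card (h' ` U)) = card (h ` U)"
    using f(4) assms(2) by (simp add: card_Suc_Diff1 del: card_Diff_insert card_Diff_singleton)
  then have "card (h' ` U) + card (insert f F) = card U"
    using count insert.hyps by simp
  ultimately show ?case by blast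
qed

lemma card_simple_tree:
  assumes "finite U" "simple_tree U F"
  shows "finite F" "card F = card U - 1"
proof -
  have tree: "simple_graph U F" "connected_graph U F" "\<nexists>c. graph_cycle F c"
    using assms(2) by (auto simp: simple_tree_def)
  then have "F \<subseteq> Pow U" by (auto simp: simple_graph_def)
  then show fin: "finite F" using assms(1) finite_subset by blast
  obtain h :: "'a \<Rightarrow> 'a" where h: "\<And>a b. h a = h b \<longleftrightarrow> (a, b) \<in> (adj F)\<^sup>*"
    and count: "card (h ` U) + card F = card U"
    using forest_component_labelling[OF fin assms(1) tree(1,3)] by blast
  obtain r where "r \<in> U" using tree(2) by (auto simp: connected_graph_def)
  then have "h ` U = {h r}" using tree(2) h by (auto simp: connected_graph_def)
  then show "card F = card U - 1" using count by simp
qed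

lemma card_assigned_graph:
  assumes "labelled_multihypergraph H" "tree_assignment H F"
  shows "card (assigned_graph H F) = total_excess H"
proof -
  have tree: "finite (F e)" "card (F e) = card (supp H e) - 1" if "e \<in> hedges H" for e
  proof -
    have "finite (supp H e)" "simple_tree (supp H e) (F e)"
      using assms that
      by (auto simp: labelled_multihypergraph_def tree_assignment_def intro: finite_subset)
    then show "finite (F e)" "card (F e) = card (supp H e) - 1"
      using card_simple_tree by blast+
  qed
  have "assigned_graph H F = Sigma (hedges H) F"
    by (auto simp: assigned_graph_def labelled_edges_def)
  then show ?thesis
    using assms(1) tree by (simp add: labelled_multihypergraph_def total_excess_def)
qed

lemma card_ordered_tree_decomposition:
  assumes "finite V" "ordered_tree_decomposition k V G Ts"
  shows "card G = k * (card V - 1)"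
proof -
  have G: "G = (\<Union>i<k. Ts ! i)"
    and disj: "\<forall>i\<in>{..<k}. \<forall>j\<in>{..<k}. i \<noteq> j \<longrightarrow> Ts ! i \<inter> Ts ! j = {}"
    and inj: "\<And>i. i < k \<Longrightarrow> inj_on snd (Ts ! i)"
    and tree: "\<And>i. i < k \<Longrightarrow> simple_tree V (snd ` (Ts ! i))"
    using assms(2) by (auto simp: ordered_tree_decomposition_def spanning_tree_occ_def)
  have fin: "finite (Ts ! i)" and card: "card (Ts ! i) = card V - 1" if "i < k" for i
    using card_simple_tree[OF assms(1) tree[OF that]] inj[OF that]
    by (simp_all add: finite_image_iff card_image)
  have "card G = (\<Sum>i<k. card (Ts ! i))"
    unfolding G using fin disj by (intro card_UN_disjoint) auto
  then show ?thesis using card by simp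
qed

theorem theorem1p2:
  fixes H :: "('v, 'e) multihypergraph" and k t :: nat
  assumes "k \<ge> 1"
    and "labelled_multihypergraph H"
    and "card (hverts H) = t"
    and "t \<ge> 2"
  shows "(has_distinguishable_tree_assignment k H \<longrightarrow> total_excess H = k * (t - 1)) \<and>
    (weakly_partition_connected k H \<and> total_excess H > k * (t - 1) \<longrightarrow>
       \<not> has_distinguishable_tree_assignment k H)"
proof -
  have "total_excess H = k * (t - 1)" if distinguishable: "has_distinguishable_tree_assignment k H"
  proof -
    obtain F Ts where F: "tree_assignment H F"
      and Ts: "ordered_tree_decomposition k (hverts H) (assigned_graph H F) Ts"
      using distinguishable
      by (auto simp: has_distinguishable_tree_assignment_def distinguishable_def)
    have "finite (hverts H)" using assms(2) by (simp add: labelled_multihypergraph_def)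
    then show ?thesis
      using card_assigned_graph[OF assms(2) F] card_ordered_tree_decomposition[OF _ Ts] assms(3)
      by simp
  qed
  then show ?thesis by auto
qed

end
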